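(* Let $q$ be a prime power, let $n\geq 2$ and $1\leq s\leq 2n-1$ be integers with $\gcd(s,n)=1$, and let $\alpha,\beta\in\mathbb{F}_{q^{2n}}$ satisfy $\mathrm{N}_{q^{2n}/q^n}(\alpha)\neq \mathrm{N}_{q^{2n}/q^n}(\beta)$. Let $\sigma\colon x\mapsto x^{q^s}$, let $f(x)=\alpha x^{\sigma}+\beta x^{\sigma q^n}=\alpha x^{q^s}+\beta x^{q^{s+n}}$ for $x\in\mathbb{F}_{q^{2n}}$, and let $U_f=\{(x,f(x))\colon x\in\mathbb{F}_{q^{2n}}\}$. Then each point of the $\mathbb{F}_q$-linear set $L_f=L_{U_f}$ of $\mathrm{PG}(1,q^{2n})$ has weight at most two with respect to $L_f$.
   Context: $\mathrm{N}_{q^{2n}/q^n}(x)=x^{q^n+1}$ is the norm from $\mathbb{F}_{q^{2n}}$ to $\mathbb{F}_{q^n}$. The points of $\mathrm{PG}(1,q^{2n})=\mathrm{PG}(\mathbb{F}_{q^{2n}}\times\mathbb{F}_{q^{2n}},\mathbb{F}_{q^{2n}})$ are the 1-dimensional $\mathbb{F}_{q^{2n}}$-subspaces of $\mathbb{F}_{q^{2n}}\times\mathbb{F}_{q^{2n}}$. For an $\mathbb{F}_q$-subspace $U$ of $\mathbb{F}_{q^{2n}}\times\mathbb{F}_{q^{2n}}$, the $\mathbb{F}_q$-linear set defined by $U$ is the point set $L_U=\{\langle \mathbf{u}\rangle_{\mathbb{F}_{q^{2n}}}\colon \mathbf{u}\in U\setminus\{\mathbf{0}\}\}$. The weight of a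 point $P=\langle \mathbf{v}\rangle_{\mathbb{F}_{q^{2n}}}$ with respect to $L_U$ is $\dim_{\mathbb{F}_q}(\langle \mathbf{v}\rangle_{\mathbb{F}_{q^{2n}}}\cap U)$. *)

theory Defs
  imports
    "HOL-Number_Theory.Prime_Powers"
    "HOL-Library.Product_Plus"
    "HOL-Library.Cardinality"
begin

text \<open>
  The extension of finite fields F(q^(2n)) over F(q) is given by an embedding \<open>\<iota>\<close> of a field
  type with q elements into a field type with q^(2n) elements. The scalar multiplication of F(q)
  on F(q^(2n)) x F(q^(2n)) is \<open>plane_scale \<iota>\<close>; that of F(q^(2n)) itself is \<open>plane_scale id\<close>.
\<close>

locale field_embedding =
  fixes \<iota> :: "'k::field \<Rightarrow> 'a::field"
  assumes map_one: "\<iota> 1 = 1"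
    and map_add: "\<iota> (a + b) = \<iota> a + \<iota> b"
    and map_mult: "\<iota> (a * b) = \<iota> a * \<iota> b"

definition plane_scale :: "('k \<Rightarrow> 'a::field) \<Rightarrow> 'k \<Rightarrow> 'a \<times> 'a \<Rightarrow> 'a \<times> 'a" where
  "plane_scale \<iota> c v = (\<iota> c * fst v, \<iota> c * snd v)"

lemma (in field_embedding) vector_space_plane_scale: "vector_space (plane_scale \<iota>)"
  by unfold_locales
    (simp_all add: plane_scale_def map_one map_add map_mult algebra_simps)

lemma field_embedding_id: "field_embedding (id :: 'a::field \<Rightarrow> 'a)"
  by unfold_locales simp_all

definition proj_point :: "'a::field \<times> 'a \<Rightarrow> ('a \<times> 'a) set" where
  "proj_point v = module.span (plane_scale id) {v}"

lemma proj_point_eq: "proj_point v = range (\<lambda>c. plane_scale id c v)"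
proof -
  interpret vector_space "plane_scale (id :: 'a \<Rightarrow> 'a)"
    by (rule field_embedding.vector_space_plane_scale[OF field_embedding_id])
  show ?thesis
    unfolding proj_point_def by (rule span_singleton)
qed

definition linear_set :: "('a::field \<times> 'a) set \<Rightarrow> ('a \<times> 'a) set set" where
  "linear_set U = proj_point ` (U - {0})"

definition point_weight ::
    "('k::field \<Rightarrow> 'a::field) \<Rightarrow> ('a \<times> 'a) set \<Rightarrow> ('a \<times> 'a) set \<Rightarrow> nat" where
  "point_weight \<iota> U P = vector_space.dim (plane_scale \<iota>) (P \<inter> U)"

definition field_norm :: "nat \<Rightarrow> nat \<Rightarrow> 'a::field \<Rightarrow> 'a" where
  "field_norm q n x = x ^ (q ^ n + 1)"

end

theory Submission
  imports Defs "HOL-Number_Theory.Residues" "HOL-Computational_Algebra.Polynomial"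
begin

text \<open>
  Write \<open>\<tau>\<close> for the involution \<open>x \<mapsto> x ^ q ^ n\<close>. The point through \<open>(u, f u)\<close> meets the graph of
  \<open>f\<close> in the solutions of \<open>f x = m x\<close> with \<open>m = f u / u\<close>; the norm condition makes \<open>f\<close> injective,
  so \<open>m \<noteq> 0\<close>. The map \<open>f\<close> is semilinear over the fixed field of \<open>\<tau>\<close>, over which the whole field
  has dimension two. Comparing \<open>f x = m x\<close> with the coordinates of \<open>x\<close> shows that solutions which
  are independent over the common fixed field of \<open>\<tau>\<close> and \<open>\<sigma>\<close> remain independent over the fixed
  field of \<open>\<tau>\<close>, and that a solution has coordinates in the common fixed field with respect to two
  such solutions. As \<open>s\<close> and \<open>n\<close> are coprime, the common fixed field is that of q elements.
\<close>

section \<open>Powers in finite fields\<close>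

lemma power_card_field_eq_same:
  fixes x :: "'a::field"
  assumes "finite (UNIV :: 'a set)"
  shows "x ^ CARD('a) = x"
proof (cases "x = 0")
  case True
  then show ?thesis using assms by (simp add: finite_UNIV_card_ge_0)
next
  case False
  let ?S = "UNIV - {0 :: 'a}"
  \<comment> \<open>Multiplication by \<open>x\<close> permutes the nonzero elements, hence
    preserves their product.\<close>
  have "bij_betw ((*) x) ?S ?S"
    using False by (intro bij_betwI[where g = "\<lambda>y. y / x"]) auto
  then have "(\<Prod>y\<in>?S. x * y) = \<Prod>?S"
    using prod.reindex_bij_betw[of "(*) x" ?S ?S "\<lambda>y. y"] by simp
  then have "x ^ card ?S * \<Prod>?S = \<Prod>?S"
    by (simp add: prod.distrib)
  moreover have "\<Prod>?S \<noteq> 0"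
    using assms by simp
  ultimately have "x ^ card ?S = 1"
    by simp
  moreover have "CARD('a) = Suc (card ?S)"
    by (rule card.remove[OF assms]) simp
  ultimately show ?thesis
    by (simp only: power_Suc mult_1_right)
qed

text \<open>The characteristic divides the order of the field, a power of the prime below
  \<open>q\<close>, so it is that prime and the map is an iterate of Frobenius.\<close>

lemma power_power_add:
  fixes x y :: "'a::field"
  assumes "primepow q" and "CARD('a) = q ^ d"
  shows "(x + y) ^ (q ^ j) = x ^ (q ^ j) + y ^ (q ^ j)"
proof -
  obtain p k where p: "prime p" "q = p ^ k"
    using assms(1) by (auto simp: primepow_def)
  have "CARD('a) > 0"
    using assms(2) p by (simp add: prime_gt_0_nat)
  then have "finite (UNIV :: 'a set)"
    by (simp add: card_gt_0_iff)
  then have prime: "prime CHAR('a)"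
    using finite_imp_CHAR_pos prime_CHAR_semidom by blast
  have "CHAR('a) dvd p ^ (k * d)"
    using CHAR_dvd_CARD[where 'a = 'a] assms(2) p by (simp add: power_mult)
  then have "CHAR('a) = p"
    using prime p prime_dvd_power primes_dvd_imp_eq by blast
  then show ?thesis
    using freshmans_dream'[OF prime, of "q ^ j" "k * j"] p by (simp add: power_mult)
qed

lemma power_iterate_fixed:
  fixes x :: "'a::monoid_mult"
  assumes "x ^ k = x"
  shows "x ^ (k ^ j) = x"
  using assms by (induction j) (simp_all add: power_mult)

text \<open>By Bezout some multiple of \<open>s\<close> exceeds a multiple of \<open>n\<close> by
  one, so a power map fixing \<open>x\<close> is another such map followed by
  \<open>x ^ q\<close>.\<close>

lemma power_coprime_fixed:
  fixes x :: "'a::monoid_mult"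
  assumes "coprime s n" and "s \<noteq> 0"
    and fixed_s: "x ^ (q ^ s) = x" and fixed_n: "x ^ (q ^ n) = x"
  shows "x ^ q = x"
proof -
  obtain a b where ab: "s * a = n * b + 1"
    using bezout_nat[OF assms(2), of n] assms(1) by auto
  have "x = x ^ (q ^ (s * a))"
    using power_iterate_fixed[OF fixed_s, of a] by (simp add: power_mult)
  also have "\<dots> = (x ^ (q ^ n) ^ b) ^ q"
    by (simp only: ab power_add power_mult power_one_right)
  also have "\<dots> = x ^ q"
    by (simp add: power_iterate_fixed[OF fixed_n])
  finally show ?thesis by simp
qed

section \<open>The image of the embedding\<close>

lemma (in field_embedding) map_power: "\<iota> (x ^ k) = \<iota> x ^ k"
  by (induction k) (simp_all add: map_one map_mult)

lemma (in field_embedding) inj_embedding: "inj \<iota>"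
proof (rule injI)
  fix x y assume xy: "\<iota> x = \<iota> y"
  have "\<iota> (x - y) + \<iota> y = \<iota> x"
    by (simp flip: map_add)
  then have *: "\<iota> (x - y) = 0"
    using xy by simp
  show "x = y"
  proof (rule ccontr)
    assume "x \<noteq> y"
    then have "\<iota> (x - y) * \<iota> (inverse (x - y)) = 1"
      by (simp add: map_one flip: map_mult)
    then show False using * by simp
  qed
qed

text \<open>The image consists of roots of X^q - X and already has q elements, the most this
  polynomial allows.\<close>

lemma (in field_embedding) range_eq_power_card_fixed:
  assumes "CARD('k) = q" and "q > 1"
  shows "range \<iota> = {x. x ^ q = x}"
proof (rule card_seteq)
  have fin: "finite (UNIV :: 'k set)"
    using assms by (simp add: card_ge_0_finite)
  show "range \<iota> \<subseteq> {x. x ^ q = x}"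
    using power_card_field_eq_same[OF fin] assms(1) by (auto simp flip: map_power)
  let ?p = "monom 1 q - monom 1 1 :: 'a poly"
  have "coeff ?p q = 1"
    using assms(2) by simp
  then have p: "?p \<noteq> 0"
    by (metis coeff_0 zero_neq_one)
  have roots: "{x. poly ?p x = 0} = {x. x ^ q = x}"
    by (simp add: poly_monom)
  show "finite {x :: 'a. x ^ q = x}"
    using poly_roots_finite[OF p] unfolding roots .
  have "degree ?p \<le> q"
    using assms(2) by (intro degree_diff_le degree_monom_le order.trans[OF degree_monom_le]) auto
  then show "card {x :: 'a. x ^ q = x} \<le> card (range \<iota>)"
    using card_poly_roots_bound[OF p] card_image[OF inj_embedding] assms(1)
    unfolding roots by simp
qed

section \<open>Kernel and eigenvectors of semilinear maps\<close>

text \<open>Take norms in \<open>\<alpha> * y = - (\<beta> * y ^ (q ^ n))\<close>: neither the sign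
  nor conjugating \<open>y\<close> changes the norm, so a nonzero \<open>y\<close> cancels.\<close>

lemma norm_neq_imp_trivial_kernel:
  fixes \<alpha> \<beta> y :: "'a::field"
  assumes add: "\<And>x y :: 'a. (x + y) ^ (q ^ n) = x ^ (q ^ n) + y ^ (q ^ n)"
    and invol: "(y ^ (q ^ n)) ^ (q ^ n) = y"
    and norm: "field_norm q n \<alpha> \<noteq> field_norm q n \<beta>"
    and zero: "\<alpha> * y + \<beta> * y ^ (q ^ n) = 0"
  shows "y = 0"
proof (rule ccontr)
  assume "y \<noteq> 0"
  let ?Q = "q ^ n"
  from zero have eq: "\<alpha> * y = - (\<beta> * y ^ ?Q)"
    by (simp add: eq_neg_iff_add_eq_0)
  have zero_power: "(0 :: 'a) ^ ?Q = 0"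
    by (metis add add_cancel_right_right)
  \<comment> \<open>Additivity yields this without distinguishing odd and even
    \<open>q\<close>.\<close>
  then have minus: "(- z) ^ ?Q = - (z ^ ?Q)" for z :: 'a
    using add[of "- z" z] unfolding add.left_inverse zero_power
    by (metis eq_neg_iff_add_eq_0)
  have "field_norm q n (\<alpha> * y) = field_norm q n (\<beta> * y ^ ?Q)"
    unfolding eq field_norm_def by (simp add: minus)
  then have "field_norm q n \<alpha> * field_norm q n y = field_norm q n \<beta> * field_norm q n y"
    using invol by (simp add: field_norm_def power_mult_distrib mult_ac)
  moreover have "field_norm q n y \<noteq> 0"
    using \<open>y \<noteq> 0\<close> by (simp add: field_norm_def)
  ultimately show False
    using norm by simp
qed

lemma semilinear_eigenvectors_generated_by_pair:
  fixes \<tau> \<sigma> f :: "'a::field \<Rightarrow> 'a"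
  assumes \<tau>_add: "\<And>x y. \<tau> (x + y) = \<tau> x + \<tau> y"
    and \<tau>_mult: "\<And>x y. \<tau> (x * y) = \<tau> x * \<tau> y"
    and \<tau>_invol: "\<And>x. \<tau> (\<tau> x) = x"
    and \<tau>_\<sigma>: "\<And>x. \<tau> (\<sigma> x) = \<sigma> (\<tau> x)"
    and f_add: "\<And>x y. f (x + y) = f x + f y"
    and f_semilinear: "\<And>c x. \<tau> c = c \<Longrightarrow> f (c * x) = \<sigma> c * f x"
    and "m \<noteq> 0" and "u \<noteq> 0"
    and u: "f u = m * u" and v: "f v = m * v" and w: "f w = m * w"
    and indep: "\<And>c. \<tau> c = c \<Longrightarrow> \<sigma> c = c \<Longrightarrow> v \<noteq> c * u"
  obtains a b where "\<tau> a = a" "\<sigma> a = a" "\<tau> b = b" "\<sigma> b = b" "w = a * u + b * v"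
proof -
  have \<tau>_0: "\<tau> 0 = 0"
    by (metis \<tau>_add add_cancel_right_right)
  have \<tau>_diff: "\<tau> (x - y) = \<tau> x - \<tau> y" for x y
    using \<tau>_add[of "x - y" y] by simp
  have \<tau>_eq0: "x = 0" if "\<tau> x = 0" for x
    using \<tau>_invol[of x] that \<tau>_0 by simp
  have \<tau>_divide: "\<tau> (x / y) = \<tau> x / \<tau> y" if "y \<noteq> 0" for x y
    using \<tau>_mult[of "x / y" y] \<tau>_eq0[of y] that by (auto simp: field_simps)
  \<comment> \<open>Evaluating \<open>f (c * u)\<close> in two ways gives
    \<open>\<sigma> c = c\<close>, which \<open>indep\<close> excludes.\<close>
  have \<tau>_indep: "v \<noteq> c * u" if c: "\<tau> c = c" for c
  proof
    assume v_eq: "v = c * u"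
    then have "m * (c * u) = \<sigma> c * (m * u)"
      using f_semilinear[OF c, of u] by (simp only: u v flip: v_eq)
    then have "\<sigma> c = c"
      using \<open>m \<noteq> 0\<close> \<open>u \<noteq> 0\<close> by (metis mult.left_commute mult_cancel_left mult_cancel_right)
    then show False
      using indep c v_eq by blast
  qed
  have \<tau>_lin_indep: "x = 0 \<and> y = 0"
    if "\<tau> x = x" "\<tau> y = y" "x * u + y * v = 0" for x y
  proof (cases "y = 0")
    case False
    have "v = ((0 - x) / y) * u"
      using that(3) False by (simp add: field_simps add_eq_0_iff)
    moreover have "\<tau> ((0 - x) / y) = (0 - x) / y"
      by (simp only: \<tau>_divide[OF False] \<tau>_diff that(1,2) \<tau>_0)
    ultimately show ?thesis
      using \<tau>_indep by blast
  qed (use that \<open>u \<noteq> 0\<close> in auto)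
  \<comment> \<open>Determinant of the system formed by \<open>w = a * u + b * v\<close> and its
    image under \<tau>; it vanishes only if \<tau> fixes \<open>v / u\<close>.\<close>
  define D where "D = u * \<tau> v - \<tau> u * v"
  have "D \<noteq> 0"
  proof
    assume "D = 0"
    then have "\<tau> (v / u) = v / u"
      using \<tau>_eq0[of u] \<open>u \<noteq> 0\<close> unfolding D_def by (auto simp: \<tau>_divide field_simps)
    then show False
      using \<tau>_indep[of "v / u"] \<open>u \<noteq> 0\<close> by simp
  qed
  \<comment> \<open>Cramer's rule. Since \<tau> swaps the two equations, it negates both numerators
    and \<open>D\<close>, so it fixes the quotients.\<close>
  define a where "a = (w * \<tau> v - \<tau> w * v) / D"
  define b where "b = (u * \<tau> w - \<tau> u * w) / D"
  have \<tau>_D: "\<tau> D = - D"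
    by (simp add: D_def \<tau>_diff \<tau>_mult \<tau>_invol mult.commute)
  have a: "\<tau> a = a"
    using \<open>D \<noteq> 0\<close> unfolding a_def \<tau>_divide[OF \<open>D \<noteq> 0\<close>] \<tau>_D
    by (simp add: \<tau>_diff \<tau>_mult \<tau>_invol field_simps)
  have b: "\<tau> b = b"
    using \<open>D \<noteq> 0\<close> unfolding b_def \<tau>_divide[OF \<open>D \<noteq> 0\<close>] \<tau>_D
    by (simp add: \<tau>_diff \<tau>_mult \<tau>_invol field_simps)
  have "D * w = (w * \<tau> v - \<tau> w * v) * u + (u * \<tau> w - \<tau> u * w) * v"
    unfolding D_def by (simp add: algebra_simps)
  then have w_eq: "w = a * u + b * v"
    using \<open>D \<noteq> 0\<close> unfolding a_def b_def times_divide_eq_left add_divide_distrib[symmetric]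
    by (simp add: nonzero_eq_divide_eq mult.commute)
  \<comment> \<open>Both sides are \<open>f w\<close>. Comparing coefficients is legitimate because
    \<sigma> preserves the fixed field of \<tau>.\<close>
  have "m * (a * u + b * v) = m * (\<sigma> a * u + \<sigma> b * v)"
    using w unfolding w_eq f_add f_semilinear[OF a] f_semilinear[OF b] u v
    by (simp add: algebra_simps)
  then have "(\<sigma> a - a) * u + (\<sigma> b - b) * v = 0"
    unfolding mult_cancel_left using \<open>m \<noteq> 0\<close> by (simp add: algebra_simps)
  moreover have "\<tau> (\<sigma> a - a) = \<sigma> a - a" "\<tau> (\<sigma> b - b) = \<sigma> b - b"
    by (simp_all add: \<tau>_diff \<tau>_\<sigma> a b)
  ultimately have "\<sigma> a - a = 0 \<and> \<sigma> b - b = 0"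
    by (intro \<tau>_lin_indep)
  then show ?thesis
    using that a b w_eq by simp
qed

section \<open>The weight bound\<close>

theorem proposition4p1:
  fixes q n s :: nat
    and \<iota> :: "'k::field \<Rightarrow> 'a::field"
    and \<alpha> \<beta> :: 'a
    and \<sigma> f :: "'a \<Rightarrow> 'a"
    and U\<^sub>f :: "('a \<times> 'a) set"
  assumes "primepow q"
    and "n \<ge> 2"
    and "1 \<le> s" and "s \<le> 2 * n - 1"
    and "gcd s n = 1"
    and "CARD('k) = q"
    and "CARD('a) = q ^ (2 * n)"
    and "field_embedding \<iota>"
    and "field_norm q n \<alpha> \<noteq> field_norm q n \<beta>"
    and "\<sigma> = (\<lambda>x. x ^ (q ^ s))"
    and "f = (\<lambda>x. \<alpha> * \<sigma> x + \<beta> * (\<sigma> x) ^ (q ^ n))"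
    and "U\<^sub>f = {(x, f x) | x. True}"
  shows "\<forall>P \<in> linear_set U\<^sub>f. point_weight \<iota> U\<^sub>f P \<le> 2"
proof
  fix P assume "P \<in> linear_set U\<^sub>f"
  interpret field_embedding \<iota> by fact
  interpret V: vector_space "plane_scale \<iota>"
    by (rule vector_space_plane_scale)
  have "q > 1"
    using \<open>primepow q\<close> by (rule primepow_gt_Suc_0[unfolded One_nat_def[symmetric]])
  have frob_add: "(x + y) ^ (q ^ j) = x ^ (q ^ j) + y ^ (q ^ j)" for x y :: 'a and j
    using power_power_add[OF assms(1,7)] .
  have "finite (UNIV :: 'a set)"
    using assms(7) \<open>q > 1\<close> by (simp add: card_ge_0_finite)
  then have invol: "(x ^ (q ^ n)) ^ (q ^ n) = x" for x :: 'a
    using power_card_field_eq_same[of x] assms(7)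
    by (simp add: mult_2 power_add flip: power_mult)
  have fixed: "c \<in> range \<iota>" if "c ^ (q ^ n) = c" "\<sigma> c = c" for c
    using power_coprime_fixed[of s n c q] that assms(3,5,10)
      range_eq_power_card_fixed[OF assms(6) \<open>q > 1\<close>]
    by (simp add: coprime_iff_gcd_eq_1)
  have \<sigma>_\<tau>: "\<sigma> x ^ (q ^ n) = \<sigma> (x ^ (q ^ n))" for x
    by (simp add: assms(10) mult.commute flip: power_mult)
  have f_add: "f (x + y) = f x + f y" for x y
    unfolding assms(10,11) by (simp add: frob_add algebra_simps)
  have f_semilinear: "f (c * x) = \<sigma> c * f x" if "c ^ (q ^ n) = c" for c x
  proof -
    have "\<sigma> c ^ (q ^ n) = \<sigma> c"
      by (simp add: \<sigma>_\<tau> that)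
    then show ?thesis
      by (simp add: assms(10,11) algebra_simps)
  qed
  \<comment> \<open>\<open>f x\<close> has the form treated by the kernel lemma, with
    \<open>y = \<sigma> x\<close>.\<close>
  have f_zero: "f x = 0 \<longleftrightarrow> x = 0" for x
  proof
    assume "f x = 0"
    then have "\<sigma> x = 0"
      using norm_neq_imp_trivial_kernel[OF frob_add invol assms(9), of "\<sigma> x"]
      by (simp add: assms(11))
    then show "x = 0"
      by (simp add: assms(10))
  qed (metis f_add add_cancel_right_right)
  obtain u where P: "P = proj_point (u, f u)" and u: "(u, f u) \<noteq> 0"
    using \<open>P \<in> linear_set U\<^sub>f\<close> by (auto simp: linear_set_def assms(12))
  have "u \<noteq> 0"
    using u f_zero by (auto simp: zero_prod_def)
  \<comment> \<open>The slope of the line \<open>P\<close>: its vectors are the pairs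
    \<open>(w, m * w)\<close>.\<close>
  define m where "m = f u / u"
  have "m \<noteq> 0" and fu: "f u = m * u"
    using \<open>u \<noteq> 0\<close> f_zero by (auto simp: m_def)
  have PU: "x \<in> P \<inter> U\<^sub>f \<Longrightarrow> \<exists>w. x = (w, f w) \<and> f w = m * w" for x
    by (auto simp: P proj_point_eq plane_scale_def assms(12) fu mult.left_commute)
  \<comment> \<open>A spanning set bounds the dimension; one or two vectors are taken, according to
    whether all solutions of \<open>f v = m * v\<close> are multiples of \<open>u\<close> over the
    small field.\<close>
  have "\<exists>B. finite B \<and> card B \<le> 2 \<and> P \<inter> U\<^sub>f \<subseteq> V.span B"
  proof (cases "\<exists>v. f v = m * v \<and> (\<forall>c. v \<noteq> \<iota> c * u)")
    case True
    then obtain v where fv: "f v = m * v" and indep: "\<And>c. v \<noteq> \<iota> c * u"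
      by blast
    have indep_fixed: "v \<noteq> c * u" if "c ^ (q ^ n) = c" "\<sigma> c = c" for c
      using fixed[OF that] indep by blast
    have "P \<inter> U\<^sub>f \<subseteq> V.span {(u, f u), (v, f v)}"
    proof
      fix x assume "x \<in> P \<inter> U\<^sub>f"
      then obtain w where x: "x = (w, f w)" and fw: "f w = m * w"
        using PU by blast
      obtain a b where "a ^ (q ^ n) = a" "\<sigma> a = a" "b ^ (q ^ n) = b" "\<sigma> b = b"
        and w: "w = a * u + b * v"
        by (rule semilinear_eigenvectors_generated_by_pair
            [of "\<lambda>x. x ^ (q ^ n)" \<sigma> f m u v w])
          (use frob_add invol \<sigma>_\<tau> f_add f_semilinear \<open>m \<noteq> 0\<close> \<open>u \<noteq> 0\<close> fu fv fw indep_fixed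
           in \<open>simp_all add: power_mult_distrib\<close>)
      then obtain a' b' where "a = \<iota> a'" "b = \<iota> b'"
        using fixed by blast
      then have "x = plane_scale \<iota> a' (u, f u) + plane_scale \<iota> b' (v, f v)"
        unfolding x fw by (simp add: w plane_scale_def fu fv algebra_simps)
      then show "x \<in> V.span {(u, f u), (v, f v)}"
        by (simp add: V.span_add V.span_scale V.span_base)
    qed
    then show ?thesis
      by (intro exI[of _ "{(u, f u), (v, f v)}"]) (simp add: card_insert_if)
  next
    case False
    have "P \<inter> U\<^sub>f \<subseteq> V.span {(u, f u)}"
    proof
      fix x assume "x \<in> P \<inter> U\<^sub>f"
      then obtain w where x: "x = (w, f w)" and fw: "f w = m * w"
        using PU by blast
      obtain c where "w = \<iota> c * u"
        using False fw by blast
      then have "x = plane_scale \<iota> c (u, f u)"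
        using x fw fu by (simp add: plane_scale_def)
      then show "x \<in> V.span {(u, f u)}"
        by (simp add: V.span_scale V.span_base)
    qed
    then show ?thesis
      by (intro exI[of _ "{(u, f u)}"]) simp
  qed
  then obtain B where "finite B" "card B \<le> 2" "P \<inter> U\<^sub>f \<subseteq> V.span B"
    by blast
  then show "point_weight \<iota> U\<^sub>f P \<le> 2"
    unfolding point_weight_def using V.dim_le_card[of "P \<inter> U\<^sub>f" B] by linarith
qed

end
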